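(* Let $\pi:P\rightarrow M$ be a discrete principal bundle with structure group $G$, and let $f\in \mathrm{Map}(P,G)^{G}$, with associated gauge transformation $\phi_{f}:P\to P$, $\phi_f(p)=p\cdot f(p)$. Then $P$ is a quandle under the binary operation $$p_{1}\triangleleft^{f} p_{2}:=p_{1}\cdot \bigl(f(p_{1})^{-1}f(p_{2})\bigr)=\phi_{f}^{-1}(p_{1})\cdot f(p_{2}),\qquad p_1,p_2\in P.$$
   Context: A rack is a set $X$ with a binary operation $\triangleleft:X\times X\to X$ such that $(x\triangleleft y)\triangleleft z=(x\triangleleft z)\triangleleft(y\triangleleft z)$ for all $x,y,z\in X$ and such that for each $x\in X$ the map $-\triangleleft x:X\to X$ is bijective. A quandle is a rack with $x\triangleleft x=x$ for all $x\in X$. Let $P,M$ be sets and $G$ a group. $P$ is a discrete principal bundle over $M$ with structure group $G$ if there are a surjective map $\pi:P\to M$ and a right action $P\times G\to P$, $(p,g)\mapsto p\cdot g$, such that: for each $m\in M$ there is a bijection $\psi_m:\pi^{-1}(m)\to G$; the action satisfies $\pi(p\cdot g)=\pi(p)$; $G$ acts freely and transitively on each fiber $\pi^{-1}(m)$; and $\psi_m(p\cdot g)=\psi_m(p)g$ for $p\in\pi^{-1}(m)$, $g\in G$. $\mathrm{Map}(P,G)^G$ denotes the set of maps $f:P\to G$ with $f(p\cdot g)=g^{-1}f(p)g$ for all $p\in P$, $g\in G$. A gauge transformation of $P$ is a bijection $\phi:P\to P$ with $\pi\circ\phi=\pi$ and $\phi(p\cdot g)=\phi(p)\cdot g$ for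 all $p\in P$, $g\in G$. *)

theory Defs
  imports "HOL-Algebra.Group"
begin

locale rack =
  fixes X :: "'a set" and rop :: "'a \<Rightarrow> 'a \<Rightarrow> 'a"
  assumes closed: "\<lbrakk>x \<in> X; y \<in> X\<rbrakk> \<Longrightarrow> rop x y \<in> X"
    and self_distrib:
      "\<lbrakk>x \<in> X; y \<in> X; z \<in> X\<rbrakk> \<Longrightarrow> rop (rop x y) z = rop (rop x z) (rop y z)"
    and right_bij: "x \<in> X \<Longrightarrow> bij_betw (\<lambda>y. rop y x) X X"

locale quandle = rack +
  assumes idem: "x \<in> X \<Longrightarrow> rop x x = x"

locale right_group_action = group G
  for P :: "'p set" and G :: "('g, 'h) monoid_scheme" (structure)
    and act :: "'p \<Rightarrow> 'g \<Rightarrow> 'p" +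
  assumes act_closed: "\<lbrakk>p \<in> P; g \<in> carrier G\<rbrakk> \<Longrightarrow> act p g \<in> P"
    and act_one: "p \<in> P \<Longrightarrow> act p \<one> = p"
    and act_mult:
      "\<lbrakk>p \<in> P; g \<in> carrier G; k \<in> carrier G\<rbrakk> \<Longrightarrow> act p (g \<otimes> k) = act (act p g) k"

definition fiber :: "'p set \<Rightarrow> ('p \<Rightarrow> 'm) \<Rightarrow> 'm \<Rightarrow> 'p set" where
  "fiber P \<pi> m = {p \<in> P. \<pi> p = m}"

locale discrete_principal_bundle = right_group_action P G act
  for P :: "'p set" and M :: "'m set" and G :: "('g, 'h) monoid_scheme" (structure)
    and \<pi> :: "'p \<Rightarrow> 'm" and act :: "'p \<Rightarrow> 'g \<Rightarrow> 'p" +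
  assumes proj_surj: "\<pi> ` P = M"
    and proj_act: "\<lbrakk>p \<in> P; g \<in> carrier G\<rbrakk> \<Longrightarrow> \<pi> (act p g) = \<pi> p"
    and free_on_fiber:
      "\<lbrakk>m \<in> M; p \<in> fiber P \<pi> m; g \<in> carrier G; act p g = p\<rbrakk> \<Longrightarrow> g = \<one>"
    and transitive_on_fiber:
      "\<lbrakk>m \<in> M; p \<in> fiber P \<pi> m; q \<in> fiber P \<pi> m\<rbrakk> \<Longrightarrow> \<exists>g \<in> carrier G. act p g = q"
    and trivialization:
      "m \<in> M \<Longrightarrow> \<exists>\<psi>. bij_betw \<psi> (fiber P \<pi> m) (carrier G) \<and>
         (\<forall>p \<in> fiber P \<pi> m. \<forall>g \<in> carrier G. \<psi> (act p g) = \<psi> p \<otimes> g)"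

definition equivariant_maps ::
    "'p set \<Rightarrow> ('g, 'h) monoid_scheme \<Rightarrow> ('p \<Rightarrow> 'g \<Rightarrow> 'p) \<Rightarrow> ('p \<Rightarrow> 'g) set" where
  "equivariant_maps P G act =
     {f \<in> P \<rightarrow> carrier G. \<forall>p \<in> P. \<forall>g \<in> carrier G.
        f (act p g) = inv\<^bsub>G\<^esub> g \<otimes>\<^bsub>G\<^esub> f p \<otimes>\<^bsub>G\<^esub> g}"

definition gauge_transformation ::
    "'p set \<Rightarrow> ('g, 'h) monoid_scheme \<Rightarrow> ('p \<Rightarrow> 'm) \<Rightarrow> ('p \<Rightarrow> 'g \<Rightarrow> 'p) \<Rightarrow> ('p \<Rightarrow> 'p) \<Rightarrow> bool" where
  "gauge_transformation P G \<pi> act \<phi> \<longleftrightarrow>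
     bij_betw \<phi> P P \<and> (\<forall>p \<in> P. \<pi> (\<phi> p) = \<pi> p) \<and>
     (\<forall>p \<in> P. \<forall>g \<in> carrier G. \<phi> (act p g) = act (\<phi> p) g)"

definition gauge_map :: "('p \<Rightarrow> 'g \<Rightarrow> 'p) \<Rightarrow> ('p \<Rightarrow> 'g) \<Rightarrow> 'p \<Rightarrow> 'p" where
  "gauge_map act f p = act p (f p)"

definition gauge_op ::
    "('g, 'h) monoid_scheme \<Rightarrow> ('p \<Rightarrow> 'g \<Rightarrow> 'p) \<Rightarrow> ('p \<Rightarrow> 'g) \<Rightarrow> 'p \<Rightarrow> 'p \<Rightarrow> 'p" where
  "gauge_op G act f p1 p2 = act p1 (inv\<^bsub>G\<^esub> (f p1) \<otimes>\<^bsub>G\<^esub> f p2)"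

end

theory Submission
  imports Defs
begin

text \<open>Every \<open>f p\<close> is fixed under conjugation by itself, so \<open>f\<close> is invariant
  under \<open>p \<mapsto> p \<cdot> f p\<close>; hence \<open>p \<mapsto> p \<cdot> (f p)\<inverse>\<close> inverts the gauge map, and right
  translation by \<open>q\<close> is this inverse followed by the action of \<open>f q\<close>.
  Since \<open>f (p \<lhd> q) = (f q)\<inverse> f p f q\<close>, both sides of self-distributivity equal
  \<open>x \<cdot> ((f x)\<inverse> (f x)\<inverse> f y f z)\<close>.\<close>

text \<open>Once \<open>m_assoc\<close> nests products to the right, an inverse pair may be followed
  by a further factor; these rules cancel it there.\<close>

lemma (in group) inv_mult_cancel_left [simp]:
  assumes "a \<in> carrier G" "b \<in> carrier G"
  shows "inv a \<otimes> (a \<otimes> b) = b" and "a \<otimes> (inv a \<otimes> b) = b"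
  using assms by (simp_all flip: m_assoc)

context right_group_action
begin

lemma act_bij: "g \<in> carrier G \<Longrightarrow> bij_betw (\<lambda>p. act p g) P P"
  by (rule bij_betw_byWitness[where f' = "\<lambda>p. act p (inv g)"])
    (auto simp: act_closed act_one simp flip: act_mult)

context
  fixes f
  assumes f: "f \<in> equivariant_maps P G act"
begin

lemma equivariant_closed [simp]: "p \<in> P \<Longrightarrow> f p \<in> carrier G"
  using f by (auto simp: equivariant_maps_def)

lemma equivariant_act:
  "\<lbrakk>p \<in> P; g \<in> carrier G\<rbrakk> \<Longrightarrow> f (act p g) = inv g \<otimes> f p \<otimes> g"
  using f by (auto simp: equivariant_maps_def)

lemma gauge_map_closed: "p \<in> P \<Longrightarrow> gauge_map act f p \<in> P"
  by (simp add: gauge_map_def act_closed)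

lemma gauge_map_inverse:
  assumes "p \<in> P"
  shows "gauge_map act f (act p (inv (f p))) = p"
    and "act (gauge_map act f p) (inv (f (gauge_map act f p))) = p"
  using assms by (simp_all add: gauge_map_def equivariant_act m_assoc act_one flip: act_mult)

lemma gauge_map_bij: "bij_betw (gauge_map act f) P P"
  by (rule bij_betw_byWitness[where f' = "\<lambda>p. act p (inv (f p))"])
    (auto simp: gauge_map_inverse gauge_map_closed act_closed)

lemma inv_into_gauge_map:
  assumes "p \<in> P"
  shows "inv_into P (gauge_map act f) p = act p (inv (f p))"
  \<comment> \<open>Injectivity on \<open>P\<close> makes the explicit preimage the value of
    \<open>inv_into\<close>.\<close>
  using assms gauge_map_bij
  by (intro inv_into_f_eq) (auto simp: bij_betw_def gauge_map_inverse act_closed)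

text \<open>The factor \<open>inv g\<close> produced by equivariance cancels the \<open>g\<close>
  already applied, leaving \<open>act p (f p \<otimes> g)\<close>.\<close>

lemma gauge_map_act:
  assumes "p \<in> P" "g \<in> carrier G"
  shows "gauge_map act f (act p g) = act (gauge_map act f p) g"
  using assms by (simp add: gauge_map_def equivariant_act m_assoc flip: act_mult)

lemma gauge_op_closed:
  "\<lbrakk>p \<in> P; q \<in> P\<rbrakk> \<Longrightarrow> gauge_op G act f p q \<in> P"
  by (simp add: gauge_op_def act_closed)

lemma gauge_op_eq_act_inv_into:
  "\<lbrakk>p \<in> P; q \<in> P\<rbrakk> \<Longrightarrow> gauge_op G act f p q = act (inv_into P (gauge_map act f) p) (f q)"
  by (simp add: gauge_op_def inv_into_gauge_map act_mult)

text \<open>Acting by \<open>inv (f p) \<otimes> f q\<close> conjugates \<open>f p\<close> first by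
  its own inverse, which fixes it, and then by \<open>f q\<close>.\<close>

lemma equivariant_gauge_op:
  assumes "p \<in> P" "q \<in> P"
  shows "f (gauge_op G act f p q) = inv (f q) \<otimes> f p \<otimes> f q"
  using assms by (simp add: gauge_op_def equivariant_act inv_mult_group m_assoc)

lemma gauge_op_self_distrib:
  assumes "x \<in> P" "y \<in> P" "z \<in> P"
  shows "gauge_op G act f (gauge_op G act f x y) z
    = gauge_op G act f (gauge_op G act f x z) (gauge_op G act f y z)"
proof -
  \<comment> \<open>Both sides become one action on \<open>x\<close>, reducing the claim to an
    identity in \<open>G\<close>; the instances are \<open>y\<close>, \<open>z\<close> and
    \<open>z\<close>, \<open>gauge_op G act f y z\<close>.\<close>
  have gauge_op_act: "gauge_op G act f (gauge_op G act f x u) v =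
      act x (inv (f x) \<otimes> f u \<otimes> (inv (f (gauge_op G act f x u)) \<otimes> f v))"
    if "u \<in> P" "v \<in> P" for u v
    using assms that
    by (simp add: gauge_op_def act_closed flip: act_mult)
  show ?thesis
    using assms
    by (simp add: gauge_op_act gauge_op_closed equivariant_gauge_op inv_mult_group m_assoc)
qed

lemma gauge_op_right_bij:
  assumes "q \<in> P"
  shows "bij_betw (\<lambda>p. gauge_op G act f p q) P P"
proof -
  have "bij_betw ((\<lambda>p. act p (f q)) \<circ> inv_into P (gauge_map act f)) P P"
    using assms by (intro bij_betw_trans[OF bij_betw_inv_into[OF gauge_map_bij] act_bij]) simp
  then show ?thesis
    \<comment> \<open>The factorization holds only for points of \<open>P\<close>, so the two maps
      are compared on \<open>P\<close> alone.\<close>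
    using assms by (simp add: gauge_op_eq_act_inv_into cong: bij_betw_cong)
qed

lemma quandle_gauge_op: "quandle P (gauge_op G act f)"
proof
  show "gauge_op G act f x x = x" if "x \<in> P" for x
    using that by (simp add: gauge_op_def act_one)
qed (fact gauge_op_closed gauge_op_self_distrib gauge_op_right_bij)+

end

end

text \<open>Fibers are preserved because \<open>p\<close> is moved by a group element, namely
  \<open>f p\<close>.\<close>

lemma (in discrete_principal_bundle) gauge_transformation_gauge_map:
  assumes "f \<in> equivariant_maps P G act"
  shows "gauge_transformation P G \<pi> act (gauge_map act f)"
  unfolding gauge_transformation_def
  using gauge_map_bij[OF assms] gauge_map_act[OF assms] equivariant_closed[OF assms]
  by (auto simp: gauge_map_def proj_act)

theorem theorem6:
  fixes P :: "'p set" and M :: "'m set" and G :: "('g, 'h) monoid_scheme"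
    and \<pi> :: "'p \<Rightarrow> 'm" and act :: "'p \<Rightarrow> 'g \<Rightarrow> 'p" and f :: "'p \<Rightarrow> 'g"
  assumes "discrete_principal_bundle P M G \<pi> act"
    and "f \<in> equivariant_maps P G act"
  shows "gauge_transformation P G \<pi> act (gauge_map act f)
    \<and> quandle P (gauge_op G act f)
    \<and> (\<forall>p1 \<in> P. \<forall>p2 \<in> P.
         gauge_op G act f p1 p2 = act (inv_into P (gauge_map act f) p1) (f p2))"
proof -
  interpret discrete_principal_bundle P M G \<pi> act by fact
  show ?thesis
    using gauge_transformation_gauge_map quandle_gauge_op gauge_op_eq_act_inv_into assms(2)
    by blast
qed

end
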